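(* Let $(r_n)_{n=1}^\infty$ be a sequence of real numbers with $r_n>0$ for all $n$ such that the series $c=\sum_{n=1}^\infty r_n$ converges. Let $\mathcal{B}_{\leq r}=\prod_{n=1}^\infty\mathcal{B}_{\leq r_n}$ be the direct product set equipped with the $\ell^\infty$ (supremum) distance $\sup_{n\ge 1} d_{\mathrm{GH}}(X_n,Y_n)$. Then $\mathcal{B}_{\leq r}$ can be isometrically embedded into $\mathcal{B}_{36c-3r_1}$; namely, there exists a map $\mathfrak{S}_r:\mathcal{B}_{\leq r}\to\mathcal{B}_{36c-3r_1}$ satisfying $$d_{\mathrm{GH}}(\mathfrak{S}_r(X),\mathfrak{S}_r(Y))=\max_{n=1,2,\ldots}d_{\mathrm{GH}}(X_n,Y_n)$$ for all $X=(X_n)_{n=1}^\infty,\ Y=(Y_n)_{n=1}^\infty\in\mathcal{B}_{\leq r}$ (in particular, the maximum on the right-hand side is attained).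
   Context: For sets $X,Y$, let $\mathrm{GHC}(X,Y)$ be the set of all correspondences, i.e. subsets $R\subset X\times Y$ such that for every $x\in X$ there is $y\in Y$ with $(x,y)\in R$ and for every $y\in Y$ there is $x\in X$ with $(x,y)\in R$. For metric spaces $(X,d_X),(Y,d_Y)$ and $R\in\mathrm{GHC}(X,Y)$, the distortion is $\mathrm{dis}(R)=\sup\{|d_X(x,\xi)-d_Y(y,\eta)| : (x,y),(\xi,\eta)\in R\}$, and the Gromov-Hausdorff distance is $d_{\mathrm{GH}}(X,Y)=\frac12\inf_{R\in\mathrm{GHC}(X,Y)}\mathrm{dis}(R)$. The Gromov-Hausdorff space is the metric space $(\mathcal{M},d_{\mathrm{GH}})$, where $\mathcal{M}$ is a set of nonempty compact metric spaces containing exactly one representative of each isometry class of nonempty compact metric spaces. The diameter of a metric space $(X,d)$ is $\mathrm{diam}(X)=\sup_{x_0,x_1\in X}d(x_0,x_1)$. For a real number $s\ge 0$, $\mathcal{B}_s=\{X\in\mathcal{M} : \mathrm{diam}(X)=s\}$ and $\mathcal{B}_{\leq s}=\{X\in\mathcal{M} : \mathrm{diam}(X)\leq s\}$, both with the restricted distance $d_{\mathrm{GH}}$. *)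

theory Defs
  imports "HOL-Analysis.Analysis"
begin

definition nonempty_compact_metric :: "'a metric \<Rightarrow> bool" where
  "nonempty_compact_metric X \<longleftrightarrow> mspace X \<noteq> {} \<and> compact_space (mtopology_of X)"

definition isometric :: "'a metric \<Rightarrow> 'b metric \<Rightarrow> bool" where
  "isometric X Y \<longleftrightarrow>
     (\<exists>f. bij_betw f (mspace X) (mspace Y) \<and>
          (\<forall>x\<in>mspace X. \<forall>y\<in>mspace X. mdist Y (f x) (f y) = mdist X x y))"

definition GHC :: "'a set \<Rightarrow> 'b set \<Rightarrow> ('a \<times> 'b) set set" where
  "GHC X Y = {R. R \<subseteq> X \<times> Y \<and> (\<forall>x\<in>X. \<exists>y\<in>Y. (x, y) \<in> R) \<and> (\<forall>y\<in>Y. \<exists>x\<in>X. (x, y) \<in> R)}"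

(* The suprema below are taken in the reals, so they are meaningful only for nonempty sets that are
   bounded above.  For distortion and diam this holds when the spaces are nonempty and compact
   (bdd_above_distortion, bdd_above_diam); for gh_sup_dist it holds when the diameters of the
   spaces X n, Y n are bounded uniformly in n. *)

definition distortion :: "'a metric \<Rightarrow> 'b metric \<Rightarrow> ('a \<times> 'b) set \<Rightarrow> real" where
  "distortion X Y R =
     Sup {\<bar>mdist X x \<xi> - mdist Y y \<eta>\<bar> | x y \<xi> \<eta>. (x, y) \<in> R \<and> (\<xi>, \<eta>) \<in> R}"

definition gh_dist :: "'a metric \<Rightarrow> 'b metric \<Rightarrow> real" where
  "gh_dist X Y = 1 / 2 * (INF R\<in>GHC (mspace X) (mspace Y). distortion X Y R)"

definition diam :: "'a metric \<Rightarrow> real" where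
  "diam X = Sup {mdist X x y | x y. x \<in> mspace X \<and> y \<in> mspace X}"

(* M is a set of nonempty compact metric spaces containing exactly one representative of each
   isometry class of nonempty compact metric spaces.  It is enough to let Z range over the spaces
   whose points are real numbers: a compact metric space has at most continuum many points, so it
   is isometric to such a space (isometric_to_real_metric), and hence M represents the spaces over
   every type (gh_space_representative).  A set M exists for 'a = real (gh_space_exists). *)
definition gh_space :: "'a metric set \<Rightarrow> bool" where
  "gh_space M \<longleftrightarrow>
     (\<forall>X\<in>M. nonempty_compact_metric X) \<and>
     (\<forall>Z :: real metric. nonempty_compact_metric Z \<longrightarrow> (\<exists>!X. X \<in> M \<and> isometric Z X))"

definition diam_eq :: "'a metric set \<Rightarrow> real \<Rightarrow> 'a metric set" where
  "diam_eq M s = {X \<in> M. diam X = s}"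

definition diam_le :: "'a metric set \<Rightarrow> real \<Rightarrow> 'a metric set" where
  "diam_le M s = {X \<in> M. diam X \<le> s}"

(* Sequences are indexed by n = 1, 2, ...; PiE fixes the irrelevant value at 0. *)
definition diam_le_prod :: "'a metric set \<Rightarrow> (nat \<Rightarrow> real) \<Rightarrow> (nat \<Rightarrow> 'a metric) set" where
  "diam_le_prod M r = (\<Pi>\<^sub>E n\<in>{1..}. diam_le M (r n))"

definition gh_sup_dist :: "(nat \<Rightarrow> 'a metric) \<Rightarrow> (nat \<Rightarrow> 'a metric) \<Rightarrow> real" where
  "gh_sup_dist X Y = (SUP n\<in>{1..}. gh_dist (X n) (Y n))"

lemma bdd_above_diam:
  assumes "nonempty_compact_metric X"
  shows "bdd_above {mdist X x y | x y. x \<in> mspace X \<and> y \<in> mspace X}"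
proof -
  interpret Metric_space "mspace X" "mdist X" by simp
  have "compactin mtopology (mspace X)"
    using assms unfolding nonempty_compact_metric_def mtopology_of_def compact_space_def by simp
  then have "mbounded (mspace X)"
    using compactin_imp_mbounded by blast
  then show ?thesis
    unfolding mbounded_alt bdd_above_def by blast
qed

lemma bdd_above_distortion:
  assumes "nonempty_compact_metric X" "nonempty_compact_metric Y"
    and R: "R \<in> GHC (mspace X) (mspace Y)"
  shows "bdd_above {\<bar>mdist X x \<xi> - mdist Y y \<eta>\<bar> | x y \<xi> \<eta>. (x, y) \<in> R \<and> (\<xi>, \<eta>) \<in> R}"
proof -
  obtain A where A: "\<And>x y. \<lbrakk>x \<in> mspace X; y \<in> mspace X\<rbrakk> \<Longrightarrow> mdist X x y \<le> A"
    using bdd_above_diam[OF assms(1)] unfolding bdd_above_def by blast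
  obtain B where B: "\<And>x y. \<lbrakk>x \<in> mspace Y; y \<in> mspace Y\<rbrakk> \<Longrightarrow> mdist Y x y \<le> B"
    using bdd_above_diam[OF assms(2)] unfolding bdd_above_def by blast
  have "\<bar>mdist X x \<xi> - mdist Y y \<eta>\<bar> \<le> \<bar>A\<bar> + \<bar>B\<bar>" if "(x, y) \<in> R" "(\<xi>, \<eta>) \<in> R" for x y \<xi> \<eta>
  proof -
    have "x \<in> mspace X" "\<xi> \<in> mspace X" "y \<in> mspace Y" "\<eta> \<in> mspace Y"
      using that R by (auto simp: GHC_def)
    then show ?thesis
      using A[of x \<xi>] B[of y \<eta>] mdist_nonneg[of X x \<xi>] mdist_nonneg[of Y y \<eta>] by linarith
  qed
  then show ?thesis
    unfolding bdd_above_def by blast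
qed

lemma isometric_sym:
  assumes "isometric X Y" shows "isometric Y X"
proof -
  obtain f where f: "bij_betw f (mspace X) (mspace Y)"
    and d: "\<And>x y. \<lbrakk>x \<in> mspace X; y \<in> mspace X\<rbrakk> \<Longrightarrow> mdist Y (f x) (f y) = mdist X x y"
    using assms unfolding isometric_def by blast
  let ?g = "inv_into (mspace X) f"
  have g: "bij_betw ?g (mspace Y) (mspace X)"
    using f by (rule bij_betw_inv_into)
  have "mdist X (?g u) (?g v) = mdist Y u v" if "u \<in> mspace Y" "v \<in> mspace Y" for u v
    using that d[of "?g u" "?g v"] g f
    by (simp add: bij_betwE bij_betw_inv_into_right)
  with g show ?thesis
    unfolding isometric_def by blast
qed

lemma isometric_trans:
  assumes "isometric X Y" "isometric Y Z" shows "isometric X Z"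
proof -
  obtain f where f: "bij_betw f (mspace X) (mspace Y)"
    and d: "\<forall>x\<in>mspace X. \<forall>y\<in>mspace X. mdist Y (f x) (f y) = mdist X x y"
    using assms unfolding isometric_def by blast
  obtain g where g: "bij_betw g (mspace Y) (mspace Z)"
    and e: "\<forall>x\<in>mspace Y. \<forall>y\<in>mspace Y. mdist Z (g x) (g y) = mdist Y x y"
    using assms unfolding isometric_def by blast
  have "bij_betw (g \<circ> f) (mspace X) (mspace Z)"
    using f g by (rule bij_betw_trans)
  moreover have "\<forall>x\<in>mspace X. \<forall>y\<in>mspace X. mdist Z ((g \<circ> f) x) ((g \<circ> f) y) = mdist X x y"
    using d e f by (simp add: bij_betwE)
  ultimately show ?thesis
    unfolding isometric_def by blast
qed

lemma isometric_refl: "isometric X X"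
  unfolding isometric_def by (rule exI[of _ id]) simp

lemma isometric_nonempty_compact:
  assumes "isometric X Y" "nonempty_compact_metric X"
  shows "nonempty_compact_metric Y"
proof -
  obtain f where f: "bij_betw f (mspace X) (mspace Y)"
    and d: "\<And>x y. \<lbrakk>x \<in> mspace X; y \<in> mspace X\<rbrakk> \<Longrightarrow> mdist Y (f x) (f y) = mdist X x y"
    using assms(1) unfolding isometric_def by blast
  interpret Metric_space12 "mspace X" "mdist X" "mspace Y" "mdist Y"
    by (rule Metric_space12_mspace_mdist)
  have im: "f ` mspace X = mspace Y"
    using f by (simp add: bij_betw_imp_surj_on)
  have "homeomorphic_map M1.mtopology M2.mtopology f"
    using isometry_imp_homeomorphic_map[OF im] d by blast
  then have "M1.mtopology homeomorphic_space M2.mtopology"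
    by (rule homeomorphic_map_imp_homeomorphic_space)
  then have "compact_space M2.mtopology"
    using assms(2) homeomorphic_compact_space[of M1.mtopology M2.mtopology]
    unfolding nonempty_compact_metric_def mtopology_of_def by simp
  then show ?thesis
    using assms(2) im unfolding nonempty_compact_metric_def mtopology_of_def by auto
qed

lemma compact_metric_lepoll_real:
  assumes "nonempty_compact_metric X"
  shows "mspace X \<lesssim> (UNIV :: real set)"
proof -
  interpret Metric_space "mspace X" "mdist X" by simp
  have "compactin mtopology (mspace X)"
    using assms unfolding nonempty_compact_metric_def mtopology_of_def compact_space_def by simp
  then have "mtotally_bounded (mspace X)"
    using compactin_imp_mtotally_bounded by blast
  then have "\<forall>n. \<exists>K. finite K \<and> K \<subseteq> mspace X \<and>
      mspace X \<subseteq> (\<Union>x\<in>K. mball x (inverse (real (Suc n))))"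
    unfolding mtotally_bounded_def by simp
  then obtain K where fin: "\<And>n. finite (K n)"
    and cov: "\<And>n. mspace X \<subseteq> (\<Union>x\<in>K n. mball x (inverse (real (Suc n))))"
    by metis
  define D where "D = (\<Union>n. K n)"
  have "countable D"
    unfolding D_def using fin by (simp add: countable_finite)
  define code where
    "code x = {to_nat (n, i) | n i. \<exists>p\<in>D. i = to_nat_on D p \<and>
        x \<in> mball p (inverse (real (Suc n)))}" for x
  have "inj_on code (mspace X)"
  proof (rule inj_onI, rule ccontr)
    fix x y
    assume xy: "x \<in> mspace X" "y \<in> mspace X" "code x = code y" "x \<noteq> y"
    then have "mdist X x y > 0" by simp
    then obtain n where n: "inverse (real (Suc n)) < mdist X x y / 2"
      by (metis half_gt_zero reals_Archimedean)
    obtain p where p: "p \<in> K n" "x \<in> mball p (inverse (real (Suc n)))"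
      using cov[of n] xy(1) by blast
    then have pD: "p \<in> D" unfolding D_def by blast
    with p have "to_nat (n, to_nat_on D p) \<in> code x"
      unfolding code_def by blast
    then have "to_nat (n, to_nat_on D p) \<in> code y"
      using xy by simp
    then obtain q where q: "q \<in> D" "to_nat_on D p = to_nat_on D q"
        "y \<in> mball q (inverse (real (Suc n)))"
      unfolding code_def by auto
    then have "q = p"
      using pD \<open>countable D\<close> by (metis to_nat_on_inj)
    then have "mdist X p x < inverse (real (Suc n))" "mdist X p y < inverse (real (Suc n))"
        "p \<in> mspace X"
      using p q by auto
    then show False
      using n triangle''[of p x y] triangle[of x p y] commute[of x p] xy by linarith
  qed
  then have "mspace X \<lesssim> (UNIV :: nat set set)"
    unfolding lepoll_def by blast
  then show ?thesis
    using nat_sets_eqpoll_reals eqpoll_imp_lepoll lepoll_trans by blast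
qed

lemma isometric_to_real_metric:
  assumes "nonempty_compact_metric X"
  shows "\<exists>Z :: real metric. nonempty_compact_metric Z \<and> isometric X Z"
proof -
  interpret Metric_space "mspace X" "mdist X" by simp
  obtain h :: "_ \<Rightarrow> real" where h: "inj_on h (mspace X)"
    using compact_metric_lepoll_real[OF assms] unfolding lepoll_def by blast
  let ?g = "inv_into (mspace X) h"
  let ?d = "\<lambda>u v. mdist X (?g u) (?g v)"
  define Z where "Z = metric (h ` mspace X, ?d)"
  have "Metric_space (h ` mspace X) ?d"
    using h by unfold_locales (auto simp: commute triangle)
  then have Z: "mspace Z = h ` mspace X" "mdist Z = ?d"
    unfolding Z_def by (simp_all add: Metric_space.mspace_metric Metric_space.mdist_metric)
  have "isometric X Z"
    unfolding isometric_def Z using h by (intro exI[of _ h]) (auto simp: inj_on_imp_bij_betw)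
  then show ?thesis
    using isometric_nonempty_compact[OF _ assms] by auto
qed

lemma gh_space_representative:
  fixes M :: "'a metric set" and Z :: "'b metric"
  assumes "gh_space M" "nonempty_compact_metric Z"
  shows "\<exists>!X. X \<in> M \<and> isometric Z X"
proof -
  obtain W :: "real metric" where W: "nonempty_compact_metric W" "isometric Z W"
    using isometric_to_real_metric[OF assms(2)] by blast
  have "isometric Z X \<longleftrightarrow> isometric W X" for X :: "'a metric"
    using isometric_trans[OF W(2), of X] isometric_trans[OF isometric_sym[OF W(2)], of X] by blast
  moreover have "\<exists>!X. X \<in> M \<and> isometric W X"
    using assms(1) W(1) unfolding gh_space_def by blast
  ultimately show ?thesis by simp
qed

lemma gh_space_exists: "\<exists>M :: real metric set. gh_space M"
proof -
  define rep where "rep Z = (SOME X :: real metric. isometric Z X)" for Z :: "real metric"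
  have rep: "isometric Z (rep Z)" for Z
    unfolding rep_def by (rule someI[of _ Z]) (rule isometric_refl)
  have rep_eq: "rep Z = rep W" if "isometric Z W" for Z W
  proof -
    have "isometric Z X \<longleftrightarrow> isometric W X" for X :: "real metric"
      using isometric_trans[OF that, of X] isometric_trans[OF isometric_sym[OF that], of X] by blast
    then have "isometric Z = (isometric W :: real metric \<Rightarrow> bool)" by blast
    then show ?thesis
      unfolding rep_def by simp
  qed
  have "gh_space (rep ` {Z. nonempty_compact_metric Z})"
    unfolding gh_space_def
  proof (intro conjI ballI allI impI)
    show "nonempty_compact_metric X" if "X \<in> rep ` {Z. nonempty_compact_metric Z}" for X
      using that isometric_nonempty_compact[OF rep] by auto
  next
    fix Z :: "real metric"
    assume Z: "nonempty_compact_metric Z"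
    show "\<exists>!X. X \<in> rep ` {Z. nonempty_compact_metric Z} \<and> isometric Z X"
    proof (rule ex1I[of _ "rep Z"])
      show "rep Z \<in> rep ` {Z. nonempty_compact_metric Z} \<and> isometric Z (rep Z)"
        using Z rep by blast
      show "X = rep Z" if X: "X \<in> rep ` {Z. nonempty_compact_metric Z} \<and> isometric Z X" for X
      proof -
        obtain W where W: "X = rep W" using X by blast
        have "isometric Z W"
          using X isometric_trans[OF _ isometric_sym[OF rep[of W]]] unfolding W by blast
        then show ?thesis
          using rep_eq W by metis
      qed
    qed
  qed
  then show ?thesis by blast
qed

end

theory Submission
  imports Defs
begin

text \<open>The image of a sequence \<open>X\<close> is a string of beads. Every factor \<open>X n\<close> becomes a bead with a
  location on the real line, and points of different beads are as far apart as their locations.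
  The locations tend to \<open>0\<close>, where a one-point bead makes the string compact, and the gap between
  the bead \<open>X n\<close> and every other bead is at least \<open>r n\<close>: it sits in the middle of its own
  interval of length \<open>2 * r n\<close>, and these disjoint intervals fill \<open>{0<..2 * c}\<close> from right to
  left. Finally there is a one-point bead, the anchor, at the location \<open>36 * c - 3 * r 1\<close>,
  which is at least \<open>6 * c\<close> because \<open>0 < r 1 \<le> c\<close>. The anchor and the point at \<open>0\<close> realise
  the diameter.

  The distance between the strings of \<open>X\<close> and \<open>Y\<close> is at most the supremum of the distances of
  the factors, since correspondences between beads at the same location can be glued: distances
  between different beads do not depend on the points in them (\<open>gh_dist_string_le\<close>).

  Conversely, let \<open>R\<close> be a correspondence between the strings, of distortion \<open>e\<close>. If
  \<open>e \<ge> r n\<close>, then \<open>e\<close> is at least twice the distance of \<open>X n\<close> and \<open>Y n\<close>, because their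
  diameters do not exceed \<open>r n\<close>. If \<open>e < r n\<close>, then \<open>R\<close> matches anchor with anchor, because no
  other point is far away from all the rest (\<open>anchor_preserved\<close>). So \<open>R\<close> changes the
  distance from the anchor, which determines the location, by less than \<open>r n\<close>, and by the gaps it
  matches the points of \<open>X n\<close> with those of \<open>Y n\<close> (\<open>bead_preserved\<close>). Its restriction
  to these beads is a correspondence of distortion at most \<open>e\<close> (\<open>gh_dist_bead_le\<close>).

  The supremum is a maximum because the distances of the factors are at most \<open>r n / 2\<close> and hence
  tend to \<open>0\<close>.\<close>

section \<open>Gromov-Hausdorff distance through bounds on correspondences\<close>

lemma GHC_leftE:
  assumes "R \<in> GHC X Y" "x \<in> X"
  obtains y where "y \<in> Y" "(x, y) \<in> R"
  using assms unfolding GHC_def by blast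

lemma GHC_rightE:
  assumes "R \<in> GHC X Y" "y \<in> Y"
  obtains x where "x \<in> X" "(x, y) \<in> R"
  using assms unfolding GHC_def by blast

lemma GHC_converse: "R \<in> GHC X Y \<Longrightarrow> R\<inverse> \<in> GHC Y X"
  unfolding GHC_def by auto

lemma mdist_self [simp]: "x \<in> mspace X \<Longrightarrow> mdist X x x = 0"
  by simp

lemma distortion_le_iff:
  assumes "nonempty_compact_metric X" "nonempty_compact_metric Y" "R \<in> GHC (mspace X) (mspace Y)"
  shows "distortion X Y R \<le> e \<longleftrightarrow>
    (\<forall>x y \<xi> \<eta>. (x, y) \<in> R \<longrightarrow> (\<xi>, \<eta>) \<in> R \<longrightarrow> \<bar>mdist X x \<xi> - mdist Y y \<eta>\<bar> \<le> e)"
proof -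
  obtain x y where "(x, y) \<in> R"
    using assms(1,3) unfolding nonempty_compact_metric_def GHC_def by blast
  then have "{\<bar>mdist X x \<xi> - mdist Y y \<eta>\<bar> | x y \<xi> \<eta>. (x, y) \<in> R \<and> (\<xi>, \<eta>) \<in> R} \<noteq> {}"
    by blast
  then show ?thesis
    unfolding distortion_def by (subst cSup_le_iff[OF _ bdd_above_distortion[OF assms]]) blast+
qed

lemma distortion_nonneg:
  assumes "nonempty_compact_metric X" "nonempty_compact_metric Y" "R \<in> GHC (mspace X) (mspace Y)"
  shows "0 \<le> distortion X Y R"
proof -
  obtain x y where "(x, y) \<in> R"
    using assms(1,3) unfolding nonempty_compact_metric_def GHC_def by blast
  then have "\<bar>mdist X x x - mdist Y y y\<bar> \<le> distortion X Y R"
    using distortion_le_iff[OF assms, of "distortion X Y R"] by blast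
  then show ?thesis by linarith
qed

lemma Times_in_GHC:
  assumes "nonempty_compact_metric X" "nonempty_compact_metric Y"
  shows "mspace X \<times> mspace Y \<in> GHC (mspace X) (mspace Y)"
  using assms unfolding nonempty_compact_metric_def GHC_def by blast

lemma gh_dist_leI:
  assumes "nonempty_compact_metric X" "nonempty_compact_metric Y" "R \<in> GHC (mspace X) (mspace Y)"
    and "\<And>x y \<xi> \<eta>. \<lbrakk>(x, y) \<in> R; (\<xi>, \<eta>) \<in> R\<rbrakk> \<Longrightarrow> \<bar>mdist X x \<xi> - mdist Y y \<eta>\<bar> \<le> e"
  shows "gh_dist X Y \<le> e / 2"
proof -
  have "(INF R\<in>GHC (mspace X) (mspace Y). distortion X Y R) \<le> distortion X Y R"
    using distortion_nonneg[OF assms(1,2)] by (intro cINF_lower assms(3)) (auto simp: bdd_below_def)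
  also have "\<dots> \<le> e"
    using assms(4) by (simp add: distortion_le_iff[OF assms(1-3)])
  finally show ?thesis
    unfolding gh_dist_def by simp
qed

lemma gh_dist_geI:
  assumes "nonempty_compact_metric X" "nonempty_compact_metric Y"
    and "\<And>R. R \<in> GHC (mspace X) (mspace Y) \<Longrightarrow> a \<le> distortion X Y R / 2"
  shows "a \<le> gh_dist X Y"
proof -
  have "2 * a \<le> (INF R\<in>GHC (mspace X) (mspace Y). distortion X Y R)"
    using Times_in_GHC[OF assms(1,2)] assms(3) by (intro cINF_greatest) force+
  then show ?thesis
    unfolding gh_dist_def by simp
qed

lemma gh_dist_lessE:
  assumes "nonempty_compact_metric X" "nonempty_compact_metric Y" "gh_dist X Y < e / 2"
  obtains R where "R \<in> GHC (mspace X) (mspace Y)"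
    "\<And>x y \<xi> \<eta>. \<lbrakk>(x, y) \<in> R; (\<xi>, \<eta>) \<in> R\<rbrakk> \<Longrightarrow> \<bar>mdist X x \<xi> - mdist Y y \<eta>\<bar> \<le> e"
proof -
  obtain R where "R \<in> GHC (mspace X) (mspace Y)" "distortion X Y R / 2 < e / 2"
    using gh_dist_geI[OF assms(1,2), of "e / 2"] assms(3) by (meson not_le)
  then show ?thesis
    using that distortion_le_iff[OF assms(1,2), of R e] by simp
qed

lemma gh_dist_nonneg:
  assumes "nonempty_compact_metric X" "nonempty_compact_metric Y"
  shows "0 \<le> gh_dist X Y"
  using distortion_nonneg[OF assms] by (intro gh_dist_geI[OF assms]) simp

lemma gh_dist_self:
  assumes "nonempty_compact_metric X"
  shows "gh_dist X X = 0"
proof -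
  have "gh_dist X X \<le> 0 / 2"
    using assms by (rule gh_dist_leI[of _ _ "Id_on (mspace X)"]) (auto simp: assms GHC_def)
  then show ?thesis
    using gh_dist_nonneg[OF assms assms] by simp
qed

lemma mdist_le_diam:
  assumes "nonempty_compact_metric X" "x \<in> mspace X" "y \<in> mspace X"
  shows "mdist X x y \<le> diam X"
  unfolding diam_def using assms(2,3) by (intro cSup_upper bdd_above_diam[OF assms(1)]) blast

text \<open>Relate every point to every point: the distances that are compared both lie between \<open>0\<close> and
  \<open>e\<close>.\<close>

lemma gh_dist_le_half_diam_bound:
  assumes "nonempty_compact_metric X" "nonempty_compact_metric Y" "diam X \<le> e" "diam Y \<le> e"
  shows "gh_dist X Y \<le> e / 2"
proof (rule gh_dist_leI[OF assms(1,2) Times_in_GHC[OF assms(1,2)]])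
  fix x y \<xi> \<eta>
  assume "(x, y) \<in> mspace X \<times> mspace Y" "(\<xi>, \<eta>) \<in> mspace X \<times> mspace Y"
  then have "mdist X x \<xi> \<le> e" "mdist Y y \<eta> \<le> e"
    using mdist_le_diam[OF assms(1), of x \<xi>] mdist_le_diam[OF assms(2), of y \<eta>] assms(3,4)
    by auto
  then show "\<bar>mdist X x \<xi> - mdist Y y \<eta>\<bar> \<le> e"
    using mdist_nonneg[of X x \<xi>] mdist_nonneg[of Y y \<eta>] by linarith
qed

lemma diam_isometric:
  assumes "isometric X Y"
  shows "diam X = diam Y"
proof -
  obtain f where f: "bij_betw f (mspace X) (mspace Y)"
    and d: "\<And>x y. \<lbrakk>x \<in> mspace X; y \<in> mspace X\<rbrakk> \<Longrightarrow> mdist Y (f x) (f y) = mdist X x y"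
    using assms unfolding isometric_def by blast
  have "{mdist Y x y | x y. x \<in> mspace Y \<and> y \<in> mspace Y} =
      {mdist X x y | x y. x \<in> mspace X \<and> y \<in> mspace X}"
    unfolding bij_betw_imp_surj_on[OF f, symmetric] using d by force
  then show ?thesis
    unfolding diam_def by simp
qed

text \<open>A correspondence is carried over by the two isometries with the same distortion. This inequality,
  used in both directions, gives the invariance that allows the strings to be replaced by their
  representatives in a Gromov-Hausdorff space.\<close>

lemma gh_dist_isometric_le:
  assumes "nonempty_compact_metric X" "nonempty_compact_metric Y"
    and "isometric X X'" "isometric Y Y'"
  shows "gh_dist X' Y' \<le> gh_dist X Y"
proof (rule gh_dist_geI[OF assms(1,2)])
  fix R
  assume R: "R \<in> GHC (mspace X) (mspace Y)"
  obtain f where f: "f ` mspace X = mspace X'"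
    and df: "\<And>x y. \<lbrakk>x \<in> mspace X; y \<in> mspace X\<rbrakk> \<Longrightarrow> mdist X' (f x) (f y) = mdist X x y"
    using assms(3) unfolding isometric_def bij_betw_def by blast
  obtain g where g: "g ` mspace Y = mspace Y'"
    and dg: "\<And>x y. \<lbrakk>x \<in> mspace Y; y \<in> mspace Y\<rbrakk> \<Longrightarrow> mdist Y' (g x) (g y) = mdist Y x y"
    using assms(4) unfolding isometric_def bij_betw_def by blast
  have sub: "x \<in> mspace X" "y \<in> mspace Y" if "(x, y) \<in> R" for x y
    using that R unfolding GHC_def by auto
  have 1: "map_prod f g ` R \<subseteq> mspace X' \<times> mspace Y'"
    using sub f g by auto
  have 2: "\<exists>y'\<in>mspace Y'. (x', y') \<in> map_prod f g ` R" if "x' \<in> mspace X'" for x'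
  proof -
    obtain x y where "x' = f x" "(x, y) \<in> R"
      using \<open>x' \<in> mspace X'\<close> f R unfolding GHC_def by blast
    then show ?thesis
      using g sub by (intro bexI[of _ "g y"]) (force+)
  qed
  have 3: "\<exists>x'\<in>mspace X'. (x', y') \<in> map_prod f g ` R" if "y' \<in> mspace Y'" for y'
  proof -
    obtain x y where "y' = g y" "(x, y) \<in> R"
      using \<open>y' \<in> mspace Y'\<close> g R unfolding GHC_def by blast
    then show ?thesis
      using f sub by (intro bexI[of _ "f x"]) (force+)
  qed
  show "gh_dist X' Y' \<le> distortion X Y R / 2"
  proof (rule gh_dist_leI)
    show "map_prod f g ` R \<in> GHC (mspace X') (mspace Y')"
      using 1 2 3 unfolding GHC_def by blast
    show "nonempty_compact_metric X'" "nonempty_compact_metric Y'"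
      using assms isometric_nonempty_compact by blast+
    fix x' y' \<xi>' \<eta>'
    assume "(x', y') \<in> map_prod f g ` R" "(\<xi>', \<eta>') \<in> map_prod f g ` R"
    then obtain x y \<xi> \<eta> where *: "(x, y) \<in> R" "(\<xi>, \<eta>) \<in> R"
      "x' = f x" "y' = g y" "\<xi>' = f \<xi>" "\<eta>' = g \<eta>"
      by auto
    then show "\<bar>mdist X' x' \<xi>' - mdist Y' y' \<eta>'\<bar> \<le> distortion X Y R"
      using distortion_le_iff[OF assms(1,2) R, of "distortion X Y R"]
      by (simp add: df dg sub)
  qed
qed

lemma gh_dist_isometric:
  assumes "nonempty_compact_metric X" "nonempty_compact_metric Y"
    and "isometric X X'" "isometric Y Y'"
  shows "gh_dist X' Y' = gh_dist X Y"
  using assms gh_dist_isometric_le[of X Y X' Y'] gh_dist_isometric_le[of X' Y' X Y]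
    isometric_sym isometric_nonempty_compact
  by (metis order_antisym)

section \<open>Strings of beads\<close>

definition bead_dist :: "('i \<Rightarrow> real) \<Rightarrow> ('i \<Rightarrow> 'a metric) \<Rightarrow> 'i \<times> 'a \<Rightarrow> 'i \<times> 'a \<Rightarrow> real" where
  "bead_dist loc P u v =
     (if fst u = fst v then mdist (P (fst u)) (snd u) (snd v) else \<bar>loc (fst u) - loc (fst v)\<bar>)"

definition string :: "'i set \<Rightarrow> ('i \<Rightarrow> real) \<Rightarrow> ('i \<Rightarrow> 'a metric) \<Rightarrow> ('i \<times> 'a) metric" where
  "string I loc P = metric (SIGMA i:I. mspace (P i), bead_dist loc P)"

text \<open>The last assumption gives the triangle inequality for two points of one bead and a third point in
  another one. It also forces a bead to be a single point if its location is an accumulation point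
  of the locations, so that a sequence of points whose locations converge to this location
  converges to the bead.\<close>

locale beads =
  fixes I :: "'i set" and loc :: "'i \<Rightarrow> real" and P :: "'i \<Rightarrow> 'a metric"
  assumes nonempty: "I \<noteq> {}"
    and inj: "inj_on loc I"
    and compact_loc: "compact (loc ` I)"
    and bead: "i \<in> I \<Longrightarrow> nonempty_compact_metric (P i)"
    and small: "\<lbrakk>i \<in> I; j \<in> I; i \<noteq> j; a \<in> mspace (P i); b \<in> mspace (P i)\<rbrakk>
      \<Longrightarrow> mdist (P i) a b \<le> \<bar>loc i - loc j\<bar>"
begin

lemma Metric_space_string: "Metric_space (SIGMA i:I. mspace (P i)) (bead_dist loc P)"
proof
  show "0 \<le> bead_dist loc P u v" for u v
    unfolding bead_dist_def by simp
  show "bead_dist loc P u v = bead_dist loc P v u" for u v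
    unfolding bead_dist_def by (simp add: mdist_commute abs_minus_commute)
  show "bead_dist loc P u v = 0 \<longleftrightarrow> u = v"
    if "u \<in> (SIGMA i:I. mspace (P i))" "v \<in> (SIGMA i:I. mspace (P i))" for u v
    using that inj unfolding bead_dist_def by (auto dest: inj_onD)
  fix u v w
  assume uvw: "u \<in> (SIGMA i:I. mspace (P i))" "v \<in> (SIGMA i:I. mspace (P i))"
    "w \<in> (SIGMA i:I. mspace (P i))"
  obtain i a j b k c where eq: "u = (i, a)" "v = (j, b)" "w = (k, c)"
    by (metis surj_pair)
  have mem: "i \<in> I" "j \<in> I" "k \<in> I" "a \<in> mspace (P i)" "b \<in> mspace (P j)" "c \<in> mspace (P k)"
    using uvw unfolding eq by auto
  consider "i = j" "j = k" | "i = j" "j \<noteq> k" | "i \<noteq> j" "j = k" | "i \<noteq> j" "i = k"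
    | "i \<noteq> j" "j \<noteq> k" "i \<noteq> k"
    by blast
  then show "bead_dist loc P u w \<le> bead_dist loc P u v + bead_dist loc P v w"
  proof cases
    case 1
    then show ?thesis
      using mem mdist_triangle[of a "P k" b c] by (simp add: eq bead_dist_def)
  next
    case 4
    then show ?thesis
      using small[of i j a c] mem by (simp add: eq bead_dist_def)
  qed (simp_all add: eq bead_dist_def)
qed

lemma mspace_string [simp]: "mspace (string I loc P) = (SIGMA i:I. mspace (P i))"
  and mdist_string: "mdist (string I loc P) = bead_dist loc P"
  unfolding string_def
  by (simp_all add: Metric_space.mspace_metric[OF Metric_space_string]
      Metric_space.mdist_metric[OF Metric_space_string])

lemma string_dist_same [simp]: "mdist (string I loc P) (i, a) (i, b) = mdist (P i) a b"
  by (simp add: mdist_string bead_dist_def)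

lemma string_dist_diff: "i \<noteq> j \<Longrightarrow> mdist (string I loc P) (i, a) (j, b) = \<bar>loc i - loc j\<bar>"
  by (simp add: mdist_string bead_dist_def)

text \<open>For a sequence in the string, pass to a subsequence whose locations converge to the location of a
  bead. If this bead is visited infinitely often, use the compactness of the bead. Otherwise the
  distance to any point of the bead is eventually the difference of the locations, which tends to
  \<open>0\<close>.\<close>

lemma nonempty_compact_string: "nonempty_compact_metric (string I loc P)"
proof -
  let ?M = "SIGMA i:I. mspace (P i)"
  interpret Metric_space ?M "bead_dist loc P" by (rule Metric_space_string)
  have top: "mtopology_of (string I loc P) = mtopology"
    unfolding mtopology_of_def mspace_string mdist_string ..
  have "\<exists>l s. l \<in> ?M \<and> strict_mono s \<and> limitin mtopology (\<sigma> \<circ> s) l sequentially"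
    if \<sigma>: "range \<sigma> \<subseteq> ?M" for \<sigma> :: "nat \<Rightarrow> 'i \<times> 'a"
  proof -
    define \<iota> where "\<iota> n = fst (\<sigma> n)" for n
    define x where "x n = snd (\<sigma> n)" for n
    have \<sigma>_eq: "\<sigma> n = (\<iota> n, x n)" for n
      by (simp add: \<iota>_def x_def)
    have mem: "\<iota> n \<in> I" "x n \<in> mspace (P (\<iota> n))" for n
    proof -
      have "(\<iota> n, x n) \<in> ?M"
        unfolding \<sigma>_eq[symmetric] using \<sigma> by blast
      then show "\<iota> n \<in> I" "x n \<in> mspace (P (\<iota> n))"
        by simp_all
    qed
    have "\<forall>n. loc (\<iota> n) \<in> loc ` I"
      using mem by blast
    then obtain l s where l: "l \<in> loc ` I" and s: "strict_mono (s :: nat \<Rightarrow> nat)"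
      and lim: "((\<lambda>n. loc (\<iota> n)) \<circ> s) \<longlonglongrightarrow> l"
      using compact_imp_seq_compact[OF compact_loc] by (meson seq_compactE)
    obtain i where i: "i \<in> I" "l = loc i"
      using l by blast
    show ?thesis
    proof (cases "infinite {n. \<iota> (s n) = i}")
      case True
      obtain q where q: "strict_mono (q :: nat \<Rightarrow> nat)" "\<And>n. \<iota> (s (q n)) = i"
        using infinite_enumerate[OF True] by blast
      interpret Pi: Metric_space "mspace (P i)" "mdist (P i)" by simp
      have "compact_space Pi.mtopology"
        using bead[OF i(1)] unfolding nonempty_compact_metric_def mtopology_of_def by simp
      moreover have "range (x \<circ> (s \<circ> q)) \<subseteq> mspace (P i)"
        using mem q(2) by force
      ultimately obtain a p where a: "a \<in> mspace (P i)" and p: "strict_mono (p :: nat \<Rightarrow> nat)"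
        and lima: "limitin Pi.mtopology (x \<circ> (s \<circ> q) \<circ> p) a sequentially"
        unfolding Pi.compact_space_sequentially by blast
      have "\<sigma> (s (q (p n))) = (i, x (s (q (p n))))" for n
        using \<sigma>_eq q(2) by metis
      then have "limitin mtopology (\<sigma> \<circ> (s \<circ> q \<circ> p)) (i, a) sequentially"
        using lima i(1) a
        unfolding limit_metric_sequentially Pi.limit_metric_sequentially
        by (simp add: bead_dist_def)
      moreover have "strict_mono (s \<circ> q \<circ> p)"
        using s q(1) p by (simp add: strict_mono_o)
      ultimately show ?thesis
        using a i(1) by blast
    next
      case False
      obtain a where a: "a \<in> mspace (P i)"
        using bead[OF i(1)] unfolding nonempty_compact_metric_def by blast
      have "eventually (\<lambda>n. \<iota> (s n) \<noteq> i) sequentially"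
        using False by (simp add: cofinite_eq_sequentially[symmetric] eventually_cofinite)
      then have "eventually (\<lambda>n. \<bar>loc (\<iota> (s n)) - loc i\<bar> = bead_dist loc P ((\<sigma> \<circ> s) n) (i, a)) sequentially"
        by (rule eventually_mono) (simp add: \<sigma>_eq bead_dist_def)
      moreover have "(\<lambda>n. \<bar>loc (\<iota> (s n)) - loc i\<bar>) \<longlonglongrightarrow> 0"
        using lim i(2) by (simp add: o_def LIM_zero tendsto_rabs_zero)
      ultimately have "(\<lambda>n. bead_dist loc P ((\<sigma> \<circ> s) n) (i, a)) \<longlonglongrightarrow> 0"
        by (rule Lim_transform_eventually[rotated])
      then have "limitin mtopology (\<sigma> \<circ> s) (i, a) sequentially"
        using a i(1) mem unfolding limitin_metric_dist_null by (simp add: \<sigma>_eq)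
      then show ?thesis
        using a i(1) s by blast
    qed
  qed
  then have "compact_space mtopology"
    unfolding compact_space_sequentially by blast
  moreover have "?M \<noteq> {}"
    using nonempty bead unfolding nonempty_compact_metric_def by fastforce
  ultimately show ?thesis
    unfolding nonempty_compact_metric_def top by simp
qed

end

text \<open>The union of correspondences between beads at the same location is a correspondence between the
  strings; pairs of points in different beads do not contribute to its distortion.\<close>

lemma gh_dist_string_le:
  assumes P: "beads I loc P" and Q: "beads I loc Q"
    and d: "\<And>i. i \<in> I \<Longrightarrow> gh_dist (P i) (Q i) \<le> d"
  shows "gh_dist (string I loc P) (string I loc Q) \<le> d"
proof (rule field_le_epsilon)
  interpret P: beads I loc P by (rule P)
  interpret Q: beads I loc Q by (rule Q)
  fix e :: real
  assume "e > 0"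
  have "\<exists>R. R \<in> GHC (mspace (P i)) (mspace (Q i)) \<and>
      (\<forall>x y \<xi> \<eta>. (x, y) \<in> R \<longrightarrow> (\<xi>, \<eta>) \<in> R \<longrightarrow>
        \<bar>mdist (P i) x \<xi> - mdist (Q i) y \<eta>\<bar> \<le> 2 * (d + e))" if "i \<in> I" for i
  proof -
    have "gh_dist (P i) (Q i) < (2 * (d + e)) / 2"
      using d[OF that] \<open>e > 0\<close> by simp
    then show ?thesis
      using gh_dist_lessE[OF P.bead[OF that] Q.bead[OF that]] by metis
  qed
  then obtain R where R: "\<And>i. i \<in> I \<Longrightarrow> R i \<in> GHC (mspace (P i)) (mspace (Q i))"
    and Re: "\<And>i x y \<xi> \<eta>. \<lbrakk>i \<in> I; (x, y) \<in> R i; (\<xi>, \<eta>) \<in> R i\<rbrakk> \<Longrightarrow>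
        \<bar>mdist (P i) x \<xi> - mdist (Q i) y \<eta>\<bar> \<le> 2 * (d + e)"
    by metis
  obtain i where i: "i \<in> I"
    using P.nonempty by blast
  have "0 \<le> d"
    using gh_dist_nonneg[OF P.bead[OF i] Q.bead[OF i]] d[OF i] by (rule order_trans)
  let ?R = "{((i, a), (i, b)) | i a b. i \<in> I \<and> (a, b) \<in> R i}"
  have "gh_dist (string I loc P) (string I loc Q) \<le> (2 * (d + e)) / 2"
  proof (rule gh_dist_leI[OF P.nonempty_compact_string Q.nonempty_compact_string])
    show "?R \<in> GHC (mspace (string I loc P)) (mspace (string I loc Q))"
      unfolding GHC_def P.mspace_string Q.mspace_string
    proof (intro CollectI conjI ballI)
      show "?R \<subseteq> (SIGMA i:I. mspace (P i)) \<times> (SIGMA i:I. mspace (Q i))"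
        using R unfolding GHC_def by blast
      show "\<exists>v\<in>SIGMA i:I. mspace (Q i). (u, v) \<in> ?R" if "u \<in> (SIGMA i:I. mspace (P i))" for u
      proof -
        obtain i a where "u = (i, a)" "i \<in> I" "a \<in> mspace (P i)"
          using \<open>u \<in> _\<close> by blast
        moreover from this obtain b where "b \<in> mspace (Q i)" "(a, b) \<in> R i"
          using R[of i] unfolding GHC_def by blast
        ultimately show ?thesis by blast
      qed
      show "\<exists>u\<in>SIGMA i:I. mspace (P i). (u, v) \<in> ?R" if "v \<in> (SIGMA i:I. mspace (Q i))" for v
      proof -
        obtain i b where "v = (i, b)" "i \<in> I" "b \<in> mspace (Q i)"
          using \<open>v \<in> _\<close> by blast
        moreover from this obtain a where "a \<in> mspace (P i)" "(a, b) \<in> R i"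
          using R[of i] unfolding GHC_def by blast
        ultimately show ?thesis by blast
      qed
    qed
    fix u v \<xi> \<eta>
    assume "(u, v) \<in> ?R" "(\<xi>, \<eta>) \<in> ?R"
    then obtain i a b j a' b' where *: "u = (i, a)" "v = (i, b)" "\<xi> = (j, a')" "\<eta> = (j, b')"
      "i \<in> I" "(a, b) \<in> R i" "j \<in> I" "(a', b') \<in> R j"
      by blast
    then show "\<bar>mdist (string I loc P) u \<xi> - mdist (string I loc Q) v \<eta>\<bar> \<le> 2 * (d + e)"
      using Re[of i a b a' b'] \<open>0 \<le> d\<close> \<open>e > 0\<close>
      by (cases "i = j") (simp_all add: P.string_dist_diff Q.string_dist_diff)
  qed
  then show "gh_dist (string I loc P) (string I loc Q) \<le> d + e"
    by simp
qed

section \<open>Anchored strings\<close>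

text \<open>The bead \<open>p\<close> is the anchor. All other locations lie in \<open>{0..T}\<close>, and the factor \<open>3\<close> leaves
  room for any distortion less than \<open>T\<close>: a distance from the anchor is at least \<open>2 * T\<close>, so it cannot
  correspond to a distance between two points other than the anchor, which is at most \<open>T\<close>
  as soon as there is a third bead. The bead \<open>z\<close> at \<open>0\<close> makes the location of the anchor the diameter.\<close>

locale anchored_beads = beads I loc P
  for I :: "'i set" and loc :: "'i \<Rightarrow> real" and P :: "'i \<Rightarrow> 'a metric" +
  fixes z p :: 'i and u :: 'a and T :: real
  assumes z: "z \<in> I" "z \<noteq> p" "loc z = 0"
    and p: "p \<in> I" "mspace (P p) = {u}" "3 * T \<le> loc p"
    and loc_bounds: "\<lbrakk>i \<in> I; i \<noteq> p\<rbrakk> \<Longrightarrow> 0 \<le> loc i \<and> loc i \<le> T"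
begin

lemma T_nonneg: "0 \<le> T"
  using loc_bounds[of z] z by auto

lemma dist_from_anchor:
  assumes "i \<in> I" "i \<noteq> p"
  shows "mdist (string I loc P) (p, a) (i, b) = loc p - loc i"
  using assms loc_bounds[of i] p T_nonneg by (subst string_dist_diff) auto

text \<open>The bead \<open>s\<close> is there to provide, together with \<open>z\<close>, a location in \<open>{0..T}\<close> different from
  that of any given bead, which bounds the diameter of this bead by \<open>T\<close>.\<close>

lemma dist_le_T:
  assumes "s \<in> I" "s \<noteq> z" "s \<noteq> p" "i \<in> I" "i \<noteq> p" "a \<in> mspace (P i)"
    "j \<in> I" "j \<noteq> p" "b \<in> mspace (P j)"
  shows "mdist (string I loc P) (i, a) (j, b) \<le> T"
proof (cases "i = j")
  case True
  obtain k where "k \<in> I" "k \<noteq> p" "k \<noteq> i"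
    using assms z by metis
  then have "mdist (P i) a b \<le> \<bar>loc i - loc k\<bar>"
    using small[of i k a b] assms True by auto
  then show ?thesis
    using loc_bounds[of i] loc_bounds[of k] \<open>k \<in> I\<close> \<open>k \<noteq> p\<close> assms True by auto
next
  case False
  then show ?thesis
    using loc_bounds[of i] loc_bounds[of j] assms by (auto simp: string_dist_diff)
qed

lemma diam_string:
  shows "diam (string I loc P) = loc p"
proof (rule antisym)
  obtain a where "a \<in> mspace (P z)"
    using bead z unfolding nonempty_compact_metric_def by blast
  then show "loc p \<le> diam (string I loc P)"
    using mdist_le_diam[OF nonempty_compact_string, of "(p, u)" "(z, a)"] z p
    by (simp add: dist_from_anchor)
  have le: "mdist (string I loc P) x y \<le> loc p"
    if "x \<in> mspace (string I loc P)" "y \<in> mspace (string I loc P)" for x y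
  proof -
    obtain i a j b where eq: "x = (i, a)" "y = (j, b)"
      by (metis surj_pair)
    have mem: "i \<in> I" "j \<in> I" "a \<in> mspace (P i)" "b \<in> mspace (P j)"
      using that eq by auto
    show ?thesis
    proof (cases "i = j")
      case True
      show ?thesis
      proof (cases "i = p")
        case True
        then show ?thesis
          using \<open>i = j\<close> mem eq p T_nonneg by simp
      next
        case False
        then have "mdist (P i) a b \<le> \<bar>loc i - loc p\<bar>"
          using small mem True p by blast
        then show ?thesis
          using loc_bounds[of i] False mem True eq p T_nonneg by auto
      qed
    next
      case False
      then show ?thesis
        using loc_bounds[of i] loc_bounds[of j] mem p T_nonneg
        by (cases "i = p"; cases "j = p") (auto simp: eq string_dist_diff)
    qed
  qed
  show "diam (string I loc P) \<le> loc p"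
    unfolding diam_def
  proof (rule cSup_least)
    show "{mdist (string I loc P) x y | x y.
        x \<in> mspace (string I loc P) \<and> y \<in> mspace (string I loc P)} \<noteq> {}"
      using nonempty_compact_string unfolding nonempty_compact_metric_def by blast
  qed (use le in blast)
qed

end

text \<open>Suppose that the anchor is related to a point of some other bead \<open>j\<close>. Every point outside the
  anchor is far from the anchor, so its partner is far from this point of \<open>j\<close> and must be the
  anchor. Then points at the locations \<open>0\<close> and \<open>loc s\<close> have the same partner, although their
  distance exceeds \<open>e\<close>.\<close>

lemma anchor_preserved:
  assumes P: "anchored_beads I loc P z p u T" and Q: "anchored_beads I loc Q z p v T"
    and s: "s \<in> I" "s \<noteq> z" "s \<noteq> p"
    and R: "R \<in> GHC (mspace (string I loc P)) (mspace (string I loc Q))"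
    and e: "\<And>x y \<xi> \<eta>. \<lbrakk>(x, y) \<in> R; (\<xi>, \<eta>) \<in> R\<rbrakk> \<Longrightarrow>
        \<bar>mdist (string I loc P) x \<xi> - mdist (string I loc Q) y \<eta>\<bar> \<le> e"
    and small: "e < loc s"
    and mem: "((p, a), (j, b)) \<in> R"
  shows "j = p"
proof (rule ccontr)
  assume "j \<noteq> p"
  interpret P: anchored_beads I loc P z p u T by (rule P)
  interpret Q: anchored_beads I loc Q z p v T by (rule Q)
  have sub: "R \<subseteq> (SIGMA i:I. mspace (P i)) \<times> (SIGMA i:I. mspace (Q i))"
    using R unfolding GHC_def by simp
  \<comment> \<open>\<open>e < loc s \<le> T\<close>, so the partner of \<open>(i, a')\<close> has distance more than \<open>T\<close> from \<open>(j, b)\<close>.\<close>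
  have to_anchor: "((i, a'), (p, v)) \<in> R" if i: "i \<in> I" "i \<noteq> p" "a' \<in> mspace (P i)" for i a'
  proof -
    have "(i, a') \<in> mspace (string I loc P)"
      using i by simp
    then obtain k b' where k: "((i, a'), (k, b')) \<in> R"
      using GHC_leftE[OF R] by (metis surj_pair)
    have "k = p"
    proof (rule ccontr)
      assume "k \<noteq> p"
      then have "mdist (string I loc Q) (j, b) (k, b') \<le> T"
        using Q.dist_le_T[OF s] \<open>j \<noteq> p\<close> k mem sub by blast
      then show False
        using e[OF mem k] P.dist_from_anchor[OF i(1,2), of a a'] P.loc_bounds[OF i(1,2)]
          P.loc_bounds[OF s(1,3)] P.p(3) small
        by linarith
    qed
    moreover have "b' \<in> mspace (Q k)"
      using k sub by blast
    ultimately show ?thesis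
      using k Q.p(2) by simp
  qed
  obtain a0 where a0: "a0 \<in> mspace (P z)"
    using P.bead[OF P.z(1)] unfolding nonempty_compact_metric_def by blast
  obtain a1 where a1: "a1 \<in> mspace (P s)"
    using P.bead[OF s(1)] unfolding nonempty_compact_metric_def by blast
  have "mdist (string I loc P) (z, a0) (s, a1) \<le> e"
    using e[OF to_anchor[OF P.z(1,2) a0] to_anchor[OF s(1,3) a1]] Q.p(1,2) by simp
  then show False
    using small s(2) P.z(3) P.string_dist_diff[of z s a0 a1] by fastforce
qed

text \<open>Both anchors are related only to each other, so related points have nearly the same distance from
  the anchor, that is, nearly the same location.\<close>

lemma bead_preserved:
  assumes P: "anchored_beads I loc P z p u T" and Q: "anchored_beads I loc Q z p v T"
    and s: "s \<in> I" "s \<noteq> z" "s \<noteq> p"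
    and R: "R \<in> GHC (mspace (string I loc P)) (mspace (string I loc Q))"
    and e: "\<And>x y \<xi> \<eta>. \<lbrakk>(x, y) \<in> R; (\<xi>, \<eta>) \<in> R\<rbrakk> \<Longrightarrow>
        \<bar>mdist (string I loc P) x \<xi> - mdist (string I loc Q) y \<eta>\<bar> \<le> e"
    and sep: "\<And>i. \<lbrakk>i \<in> I; i \<noteq> s\<rbrakk> \<Longrightarrow> e < \<bar>loc i - loc s\<bar>"
    and mem: "((s, a), (j, b)) \<in> R"
  shows "j = s"
proof (rule ccontr)
  assume "j \<noteq> s"
  interpret P: anchored_beads I loc P z p u T by (rule P)
  interpret Q: anchored_beads I loc Q z p v T by (rule Q)
  have sub: "R \<subseteq> (SIGMA i:I. mspace (P i)) \<times> (SIGMA i:I. mspace (Q i))"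
    using R unfolding GHC_def by simp
  have "e < loc s"
    using sep[OF P.z(1)] s P.z P.loc_bounds[OF s(1,3)] by simp
  have e': "\<And>x y \<xi> \<eta>. \<lbrakk>(x, y) \<in> R\<inverse>; (\<xi>, \<eta>) \<in> R\<inverse>\<rbrakk> \<Longrightarrow>
        \<bar>mdist (string I loc Q) x \<xi> - mdist (string I loc P) y \<eta>\<bar> \<le> e"
    using e by (metis abs_minus_commute converse_iff)
  have "j \<noteq> p"
    using anchor_preserved[OF Q P s GHC_converse[OF R] e' \<open>e < loc s\<close>, of b s a] mem s(3) by blast
  have "(p, u) \<in> mspace (string I loc P)"
    using P.p by simp
  then obtain k b' where k: "((p, u), (k, b')) \<in> R"
    using GHC_leftE[OF R] by (metis surj_pair)
  have "k = p"
    using anchor_preserved[OF P Q s R e \<open>e < loc s\<close> k] .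
  have "j \<in> I"
    using sub mem by blast
  then show False
    using e[OF k mem] P.dist_from_anchor[OF s(1,3), of u a] Q.dist_from_anchor[of j b' b]
      sep[of j] \<open>j \<noteq> p\<close> \<open>j \<noteq> s\<close> \<open>k = p\<close>
    by auto
qed

text \<open>A correspondence of distortion less than \<open>\<rho>\<close> restricts to one between the beads at \<open>s\<close>; one of
  distortion at least \<open>\<rho>\<close> is no better than relating all points of these two beads.\<close>

lemma gh_dist_bead_le:
  assumes P: "anchored_beads I loc P z p u T" and Q: "anchored_beads I loc Q z p v T"
    and s: "s \<in> I" "s \<noteq> z" "s \<noteq> p"
    and sep: "\<And>i. \<lbrakk>i \<in> I; i \<noteq> s\<rbrakk> \<Longrightarrow> \<rho> \<le> \<bar>loc i - loc s\<bar>"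
    and diam: "diam (P s) \<le> \<rho>" "diam (Q s) \<le> \<rho>"
  shows "gh_dist (P s) (Q s) \<le> gh_dist (string I loc P) (string I loc Q)"
proof -
  interpret P: anchored_beads I loc P z p u T by (rule P)
  interpret Q: anchored_beads I loc Q z p v T by (rule Q)
  show ?thesis
  proof (rule gh_dist_geI[OF P.nonempty_compact_string Q.nonempty_compact_string])
    fix R
    assume R: "R \<in> GHC (mspace (string I loc P)) (mspace (string I loc Q))"
    define e where "e = distortion (string I loc P) (string I loc Q) R"
    have e: "\<And>x y \<xi> \<eta>. \<lbrakk>(x, y) \<in> R; (\<xi>, \<eta>) \<in> R\<rbrakk> \<Longrightarrow>
        \<bar>mdist (string I loc P) x \<xi> - mdist (string I loc Q) y \<eta>\<bar> \<le> e"
      using distortion_le_iff[OF P.nonempty_compact_string Q.nonempty_compact_string R, of e]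
      unfolding e_def by blast
    show "gh_dist (P s) (Q s) \<le> distortion (string I loc P) (string I loc Q) R / 2"
    proof (cases "\<rho> \<le> e")
      case True
      have "gh_dist (P s) (Q s) \<le> \<rho> / 2"
        by (rule gh_dist_le_half_diam_bound[OF P.bead[OF s(1)] Q.bead[OF s(1)] diam])
      then show ?thesis
        using True by (simp add: e_def)
    next
      case False
      have e': "\<And>x y \<xi> \<eta>. \<lbrakk>(x, y) \<in> R\<inverse>; (\<xi>, \<eta>) \<in> R\<inverse>\<rbrakk> \<Longrightarrow>
        \<bar>mdist (string I loc Q) x \<xi> - mdist (string I loc P) y \<eta>\<bar> \<le> e"
        using e by (metis abs_minus_commute converse_iff)
      have sep': "\<And>i. \<lbrakk>i \<in> I; i \<noteq> s\<rbrakk> \<Longrightarrow> e < \<bar>loc i - loc s\<bar>"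
        using sep False by force
      have sub: "R \<subseteq> (SIGMA i:I. mspace (P i)) \<times> (SIGMA i:I. mspace (Q i))"
        using R unfolding GHC_def by simp
      let ?R = "{(a, b). ((s, a), (s, b)) \<in> R}"
      have left: "\<exists>b\<in>mspace (Q s). (a, b) \<in> ?R" if "a \<in> mspace (P s)" for a
      proof -
        have "(s, a) \<in> mspace (string I loc P)"
          using that s by simp
        then obtain j b where jb: "((s, a), (j, b)) \<in> R"
          using GHC_leftE[OF R] by (metis surj_pair)
        then have "j = s"
          using bead_preserved[OF P Q s R e sep'] by blast
        then show ?thesis
          using jb sub by blast
      qed
      have right: "\<exists>a\<in>mspace (P s). (a, b) \<in> ?R" if "b \<in> mspace (Q s)" for b
      proof -
        have "(s, b) \<in> mspace (string I loc Q)"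
          using that s by simp
        then obtain j a where ja: "((j, a), (s, b)) \<in> R"
          using GHC_rightE[OF R] by (metis surj_pair)
        then have "((s, b), (j, a)) \<in> R\<inverse>"
          by simp
        then have "j = s"
          using bead_preserved[OF Q P s GHC_converse[OF R] e' sep'] by blast
        then show ?thesis
          using ja sub by blast
      qed
      have "gh_dist (P s) (Q s) \<le> e / 2"
      proof (rule gh_dist_leI[OF P.bead[OF s(1)] Q.bead[OF s(1)]])
        show "?R \<in> GHC (mspace (P s)) (mspace (Q s))"
          using left right sub unfolding GHC_def by blast
        show "\<bar>mdist (P s) a a' - mdist (Q s) b b'\<bar> \<le> e"
          if "(a, b) \<in> ?R" "(a', b') \<in> ?R" for a b a' b'
          using that e[of "(s, a)" "(s, b)" "(s, a')" "(s, b')"] by simp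
      qed
      then show ?thesis
        by (simp add: e_def)
    qed
  qed
qed

section \<open>Placing the factors of the product\<close>

text \<open>The intervals \<open>{right_end q (Suc k)..right_end q k}\<close> of length \<open>2 * q k\<close> are laid side by side
  from \<open>2 * suminf q\<close> down to \<open>0\<close>; beads will sit at their midpoints.\<close>

definition right_end :: "(nat \<Rightarrow> real) \<Rightarrow> nat \<Rightarrow> real" where
  "right_end q k = 2 * (suminf q - sum q {..<k})"

text \<open>Index \<open>0\<close> is the limit point of the beads and index \<open>1\<close> the anchor, so the numbering of the
  factors, which starts at \<open>1\<close>, is shifted by one; \<open>q k\<close> belongs to the factor \<open>Suc k\<close>.\<close>

fun bead_loc :: "(nat \<Rightarrow> real) \<Rightarrow> real \<Rightarrow> nat \<Rightarrow> real" where
  "bead_loc q L 0 = 0"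
| "bead_loc q L (Suc 0) = L"
| "bead_loc q L (Suc (Suc k)) = right_end q k - q k"

text \<open>The two one-point beads need some point of the type \<open>'a\<close>; \<open>undefined\<close> is an arbitrary one.\<close>

fun bead_at :: "(nat \<Rightarrow> 'a metric) \<Rightarrow> nat \<Rightarrow> 'a metric" where
  "bead_at X 0 = metric ({undefined}, \<lambda>_ _. 0)"
| "bead_at X (Suc 0) = metric ({undefined}, \<lambda>_ _. 0)"
| "bead_at X (Suc (Suc k)) = X (Suc k)"

lemma Metric_space_singleton: "Metric_space {a} (\<lambda>_ _. 0)"
  by unfold_locales auto

lemma mspace_point: "mspace (metric ({a}, \<lambda>_ _. 0)) = {a}"
  by (simp add: Metric_space.mspace_metric[OF Metric_space_singleton])

lemma nonempty_compact_point: "nonempty_compact_metric (metric ({a}, \<lambda>_ _. 0))"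
  unfolding nonempty_compact_metric_def
  by (simp add: mspace_point compact_space_def finite_imp_compactin)

context
  fixes q :: "nat \<Rightarrow> real" and L :: real
  assumes q_pos: "\<And>k. q k > 0" and q_sum: "summable q" and L_ge: "6 * suminf q \<le> L"
begin

lemma right_end_antimono: "k \<le> l \<Longrightarrow> right_end q l \<le> right_end q k"
  unfolding right_end_def using q_pos by (simp add: less_imp_le sum_mono2)

lemma right_end_nonneg: "0 \<le> right_end q k"
  unfolding right_end_def using sum_le_suminf[OF q_sum, of "{..<k}"] q_pos
  by (simp add: less_imp_le)

lemma right_end_le: "right_end q k \<le> 2 * suminf q"
  using right_end_antimono[of 0 k] by (simp add: right_end_def)

lemma right_end_Suc: "right_end q (Suc k) = right_end q k - 2 * q k"
  by (simp add: right_end_def)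

text \<open>The distance of two midpoints is at least the sum of the half lengths of their disjoint
  intervals. A plain bound by \<open>q k\<close> would not serve the smaller index and the larger one at once,
  since \<open>q\<close> need not be monotone.\<close>

lemma bead_loc_sep_less:
  assumes "k < l"
  shows "q k + q l \<le> bead_loc q L (Suc (Suc k)) - bead_loc q L (Suc (Suc l))"
  using right_end_antimono[of "Suc k" l] assms by (simp add: right_end_Suc)

lemma bead_loc_sep:
  assumes "i \<noteq> Suc (Suc k)"
  shows "q k \<le> \<bar>bead_loc q L i - bead_loc q L (Suc (Suc k))\<bar>"
proof -
  consider "i = 0" | "i = Suc 0" | l where "i = Suc (Suc l)"
    by (metis not0_implies_Suc)
  then show ?thesis
  proof cases
    case 1
    then show ?thesis
      using right_end_nonneg[of "Suc k"] by (simp add: right_end_Suc)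
  next
    case 2
    then show ?thesis
      using right_end_le[of k] right_end_nonneg[of k] L_ge by auto
  next
    case (3 l)
    then show ?thesis
      using assms bead_loc_sep_less[of k l] bead_loc_sep_less[of l k] q_pos[of k] q_pos[of l]
      by (cases "k < l") auto
  qed
qed

lemma bead_loc_tendsto: "(\<lambda>k. bead_loc q L (Suc (Suc k))) \<longlonglongrightarrow> 0"
proof -
  have "(\<lambda>k. sum q {..<k}) \<longlonglongrightarrow> suminf q"
    using q_sum by (simp add: summable_LIMSEQ)
  then have "(\<lambda>k. 2 * (suminf q - sum q {..<k}) - q k) \<longlonglongrightarrow> 2 * (suminf q - suminf q) - 0"
    by (intro tendsto_intros summable_LIMSEQ_zero q_sum)
  then show ?thesis
    by (simp add: right_end_def)
qed

lemma suminf_q_pos: "0 < suminf q"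
  using q_sum q_pos by (simp add: suminf_pos)

lemma bead_loc_bounds:
  assumes "i \<noteq> Suc 0"
  shows "0 \<le> bead_loc q L i \<and> bead_loc q L i \<le> 2 * suminf q"
proof (cases "i = 0")
  case True
  then show ?thesis using suminf_q_pos by simp
next
  case False
  then obtain k where k: "i = Suc (Suc k)"
    using assms by (metis not0_implies_Suc)
  then show ?thesis
    using right_end_le[of k] right_end_nonneg[of "Suc k"] q_pos[of k] by (simp add: right_end_Suc)
qed

lemma compact_range_bead_loc: "compact (range (bead_loc q L))"
proof -
  have "n \<in> {0, Suc 0} \<union> range (\<lambda>k. Suc (Suc k))" for n :: nat
    by (cases "(q, L, n)" rule: bead_loc.cases) auto
  then have "(UNIV :: nat set) = {0, Suc 0} \<union> range (\<lambda>k. Suc (Suc k))"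
    by blast
  then have "range (bead_loc q L) = bead_loc q L ` ({0, Suc 0} \<union> range (\<lambda>k. Suc (Suc k)))"
    by (rule arg_cong)
  also have "\<dots> = insert L (insert 0 (range (\<lambda>k. bead_loc q L (Suc (Suc k)))))"
    by (simp add: image_Un image_image insert_commute)
  finally have "range (bead_loc q L) = \<dots>" .
  then show ?thesis
    using compact_sequence_with_limit[OF bead_loc_tendsto] by (simp add: compact_insert)
qed

lemma inj_bead_loc: "inj (bead_loc q L)"
proof (rule inj_onI, rule ccontr)
  fix i j
  assume eq: "bead_loc q L i = bead_loc q L j" and "i \<noteq> j"
  have "L \<noteq> 0"
    using L_ge suminf_q_pos by linarith
  then consider k where "i = Suc (Suc k)" | k where "j = Suc (Suc k)"
    using eq \<open>i \<noteq> j\<close> by (cases "(q, L, i)" rule: bead_loc.cases; cases "(q, L, j)" rule: bead_loc.cases) auto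
  then show False
  proof cases
    case (1 k)
    then show False
      using bead_loc_sep[of j k] q_pos[of k] eq \<open>i \<noteq> j\<close> by (metis abs_zero diff_self not_le)
  next
    case (2 k)
    then show False
      using bead_loc_sep[of i k] q_pos[of k] eq \<open>i \<noteq> j\<close> by (metis abs_zero diff_self not_le)
  qed
qed

lemma anchored_beads_bead_at:
  fixes X :: "nat \<Rightarrow> 'a metric"
  assumes "\<And>k. nonempty_compact_metric (X (Suc k))"
    and "\<And>k. diam (X (Suc k)) \<le> q k"
  shows "anchored_beads UNIV (bead_loc q L) (bead_at X) 0 (Suc 0) undefined (2 * suminf q)"
proof unfold_locales
  fix i j a b
  assume ij: "i \<noteq> j" and ab: "a \<in> mspace (bead_at X i)" "b \<in> mspace (bead_at X i)"
  show "mdist (bead_at X i) a b \<le> \<bar>bead_loc q L i - bead_loc q L j\<bar>"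
  proof (cases "a = b")
    case True
    then show ?thesis using ab by simp
  next
    case False
    then obtain k where k: "i = Suc (Suc k)"
      using ab by (cases "(X, i)" rule: bead_at.cases) (auto simp: mspace_point)
    then have "mdist (bead_at X i) a b \<le> q k"
      using ab mdist_le_diam[OF assms(1)[of k]] assms(2)[of k] by fastforce
    also have "\<dots> \<le> \<bar>bead_loc q L j - bead_loc q L i\<bar>"
      using bead_loc_sep[of j k] ij k by simp
    finally show ?thesis
      by (simp add: abs_minus_commute)
  qed
next
  show "nonempty_compact_metric (bead_at X i)" for i
    by (cases "(X, i)" rule: bead_at.cases) (simp_all add: nonempty_compact_point assms(1))
next
  show "inj (bead_loc q L)" "compact (range (bead_loc q L))"
    by (rule inj_bead_loc compact_range_bead_loc)+
  show "0 \<le> bead_loc q L i \<and> bead_loc q L i \<le> 2 * suminf q" if "i \<noteq> Suc 0" for i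
    using bead_loc_bounds[OF that] .
  show "3 * (2 * suminf q) \<le> bead_loc q L (Suc 0)"
    using L_ge by simp
qed (simp_all add: mspace_point)

lemma gh_dist_bead_at_eq:
  fixes X Y :: "nat \<Rightarrow> 'a metric"
  assumes X: "\<And>k. nonempty_compact_metric (X (Suc k))" "\<And>k. diam (X (Suc k)) \<le> q k"
    and Y: "\<And>k. nonempty_compact_metric (Y (Suc k))" "\<And>k. diam (Y (Suc k)) \<le> q k"
    and m: "\<And>k. gh_dist (X (Suc k)) (Y (Suc k)) \<le> gh_dist (X (Suc m)) (Y (Suc m))"
  shows "gh_dist (string UNIV (bead_loc q L) (bead_at X)) (string UNIV (bead_loc q L) (bead_at Y))
    = gh_dist (X (Suc m)) (Y (Suc m))"
proof (rule antisym)
  have P: "anchored_beads UNIV (bead_loc q L) (bead_at X) 0 (Suc 0) undefined (2 * suminf q)"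
    using X by (rule anchored_beads_bead_at)
  have Q: "anchored_beads UNIV (bead_loc q L) (bead_at Y) 0 (Suc 0) undefined (2 * suminf q)"
    using Y by (rule anchored_beads_bead_at)
  have "gh_dist (bead_at X i) (bead_at Y i) \<le> gh_dist (X (Suc m)) (Y (Suc m))" for i
    using gh_dist_nonneg[OF X(1) Y(1)] m
    by (cases "(X, i)" rule: bead_at.cases) (simp_all add: gh_dist_self nonempty_compact_point)
  then show "gh_dist (string UNIV (bead_loc q L) (bead_at X)) (string UNIV (bead_loc q L) (bead_at Y))
    \<le> gh_dist (X (Suc m)) (Y (Suc m))"
    using P Q by (intro gh_dist_string_le) (auto simp: anchored_beads_def)
  show "gh_dist (X (Suc m)) (Y (Suc m))
    \<le> gh_dist (string UNIV (bead_loc q L) (bead_at X)) (string UNIV (bead_loc q L) (bead_at Y))"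
    using gh_dist_bead_le[OF P Q, of "Suc (Suc m)" "q m"] bead_loc_sep[of _ m] X(2)[of m] Y(2)[of m] by simp
qed

end

lemma ex_max_of_null_sequence:
  fixes f :: "nat \<Rightarrow> real"
  assumes "f \<longlonglongrightarrow> 0" "\<And>k. 0 \<le> f k"
  shows "\<exists>m. \<forall>k. f k \<le> f m"
proof (cases "\<forall>k. f k = 0")
  case False
  then obtain j where "0 < f j"
    using assms(2) by (metis order_le_less)
  then obtain N where N: "\<And>k. k \<ge> N \<Longrightarrow> f k < f j"
    using order_tendstoD(2)[OF assms(1)] by (auto simp: eventually_sequentially)
  have "\<exists>m\<in>{..max N j}. \<forall>k\<in>{..max N j}. f k \<le> f m"
    using Max_in[of "f ` {..max N j}"] Max_ge[of "f ` {..max N j}"] by fastforce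
  then obtain m where "\<forall>k\<le>max N j. f k \<le> f m"
    by auto
  then have "f k \<le> f m" for k
    using N[of k] by (cases "k \<le> max N j") (force dest: spec[of _ j])+
  then show ?thesis by blast
qed auto

theorem theorem1p3:
  fixes M :: "'a metric set" and r :: "nat \<Rightarrow> real" and c :: real
  assumes "gh_space M"
    and "\<And>n. n \<ge> 1 \<Longrightarrow> r n > 0"
    and "(\<lambda>n. r (Suc n)) sums c"
  shows "\<exists>S. S \<in> diam_le_prod M r \<rightarrow> diam_eq M (36 * c - 3 * r 1) \<and>
    (\<forall>X\<in>diam_le_prod M r. \<forall>Y\<in>diam_le_prod M r.
       gh_dist (S X) (S Y) = gh_sup_dist X Y \<and>
       (\<exists>m\<ge>1. gh_dist (S X) (S Y) = gh_dist (X m) (Y m)) \<and>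
       (\<forall>n\<ge>1. gh_dist (X n) (Y n) \<le> gh_dist (S X) (S Y)))"
proof -
  define q where "q k = r (Suc k)" for k
  define L where "L = 36 * c - 3 * r 1"
  have q_pos: "\<And>k. q k > 0"
    using assms(2) by (simp add: q_def)
  have q_sum: "summable q" and c: "suminf q = c"
    using assms(3) unfolding q_def[abs_def] by (auto simp: sums_iff)
  have "q 0 \<le> c"
    using sum_le_suminf[OF q_sum, of "{0}"] q_pos c by (simp add: less_imp_le)
  then have L: "6 * suminf q \<le> L"
    using q_pos[of 0] unfolding L_def c q_def by simp
  define B where "B X = string UNIV (bead_loc q L) (bead_at X)" for X :: "nat \<Rightarrow> 'a metric"
  define S where "S X = (SOME Z. Z \<in> M \<and> isometric (B X) Z)" for X
  have X1: "nonempty_compact_metric (X (Suc k))" and X2: "diam (X (Suc k)) \<le> q k"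
    if "X \<in> diam_le_prod M r" for X k
  proof -
    have "X (Suc k) \<in> diam_le M (r (Suc k))"
      using that unfolding diam_le_prod_def by auto
    then show "nonempty_compact_metric (X (Suc k))" "diam (X (Suc k)) \<le> q k"
      using assms(1) unfolding diam_le_def gh_space_def q_def by auto
  qed
  have anch: "anchored_beads UNIV (bead_loc q L) (bead_at X) 0 (Suc 0) undefined (2 * suminf q)"
    if "X \<in> diam_le_prod M r" for X
    using that by (intro anchored_beads_bead_at q_pos q_sum L X1 X2)
  have B: "nonempty_compact_metric (B X)" "diam (B X) = L" if "X \<in> diam_le_prod M r" for X
  proof -
    interpret anchored_beads UNIV "bead_loc q L" "bead_at X" 0 "Suc 0" undefined "2 * suminf q"
      by (rule anch[OF that])
    show "nonempty_compact_metric (B X)" "diam (B X) = L"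
      using nonempty_compact_string diam_string unfolding B_def by simp_all
  qed
  have S: "S X \<in> M" "isometric (B X) (S X)" if "X \<in> diam_le_prod M r" for X
    using someI_ex[OF ex1_implies_ex[OF gh_space_representative[OF assms(1) B(1)[OF that]]]]
    unfolding S_def by auto
  have "S \<in> diam_le_prod M r \<rightarrow> diam_eq M (36 * c - 3 * r 1)"
    using S B diam_isometric unfolding diam_eq_def L_def[symmetric] by fastforce
  moreover have "\<exists>m\<ge>1. gh_dist (S X) (S Y) = gh_dist (X m) (Y m) \<and>
      (\<forall>n\<ge>1. gh_dist (X n) (Y n) \<le> gh_dist (X m) (Y m))"
    if X: "X \<in> diam_le_prod M r" and Y: "Y \<in> diam_le_prod M r" for X Y
  proof -
    have f0: "0 \<le> gh_dist (X (Suc k)) (Y (Suc k))" for k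
      using X1[OF X] X1[OF Y] by (rule gh_dist_nonneg)
    have fq: "gh_dist (X (Suc k)) (Y (Suc k)) \<le> q k / 2" for k
      by (intro gh_dist_le_half_diam_bound X1[OF X] X1[OF Y] X2[OF X] X2[OF Y])
    have half: "(\<lambda>k. q k / 2) \<longlonglongrightarrow> 0"
      using tendsto_divide_zero[OF summable_LIMSEQ_zero[OF q_sum]] .
    have "norm (gh_dist (X (Suc k)) (Y (Suc k))) \<le> q k / 2" for k
      using f0[of k] fq[of k] by simp
    then have "(\<lambda>k. gh_dist (X (Suc k)) (Y (Suc k))) \<longlonglongrightarrow> 0"
      by (intro Lim_null_comparison[OF _ half] always_eventually allI)
    then have "\<exists>m. \<forall>k. gh_dist (X (Suc k)) (Y (Suc k)) \<le> gh_dist (X (Suc m)) (Y (Suc m))"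
      using f0 by (rule ex_max_of_null_sequence)
    then obtain m where m: "\<And>k. gh_dist (X (Suc k)) (Y (Suc k)) \<le> gh_dist (X (Suc m)) (Y (Suc m))"
      by blast
    have "gh_dist (S X) (S Y) = gh_dist (B X) (B Y)"
      using X Y B S by (intro gh_dist_isometric)
    also have "\<dots> = gh_dist (X (Suc m)) (Y (Suc m))"
      unfolding B_def
      by (intro gh_dist_bead_at_eq q_pos q_sum L X1[OF X] X2[OF X] X1[OF Y] X2[OF Y] m)
    finally have "gh_dist (S X) (S Y) = gh_dist (X (Suc m)) (Y (Suc m))" .
    moreover have "gh_dist (X n) (Y n) \<le> gh_dist (X (Suc m)) (Y (Suc m))" if "n \<ge> 1" for n
      using m[of "n - 1"] that by simp
    ultimately show ?thesis
      by (intro exI[of _ "Suc m"]) simp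
  qed
  moreover have "gh_sup_dist X Y = gh_dist (X m) (Y m)"
    if "m \<ge> 1" "\<forall>n\<ge>1. gh_dist (X n) (Y n) \<le> gh_dist (X m) (Y m)" for X Y :: "nat \<Rightarrow> 'a metric" and m
    unfolding gh_sup_dist_def using that by (intro cSup_eq_maximum) auto
  ultimately show ?thesis
    by (intro exI[of _ S]) (metis (no_types, lifting))
qed

end
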